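(* Let $\mathbb{K}\in\{\mathbb{R},\mathbb{C}\}$, let $m,n\ge 1$ be integers, let $A\in\mathbb{K}^{m\times n}$ be an arbitrary matrix, $b\in\mathbb{K}^m$, $\gamma>0$ and $p\in[1,\infty)$. Then the inverse Potts functional $$P_\gamma(x)=\gamma\,\|\nabla x\|_0+\|Ax-b\|_p^p,\qquad x\in\mathbb{R}^n,$$ has a minimizer, i.e., there exists $x^*\in\mathbb{R}^n$ such that $P_\gamma(x^* )\le P_\gamma(x)$ for all $x\in\mathbb{R}^n$.
   Context: For $x=(x_1,\dots,x_n)\in\mathbb{R}^n$, $\|\nabla x\|_0=|\{i\in\{1,\dots,n-1\}: x_i\ne x_{i+1}\}|$ denotes the number of jumps of $x$. For $y\in\mathbb{K}^m$, $\|y\|_p^p=\sum_{i=1}^m|y_i|^p$. The minimization problem for $P_\gamma$ is called the inverse Potts problem. *)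

theory Defs
  imports Complex_Main "Jordan_Normal_Form.Matrix"
begin

text \<open>Vectors are indexed from 0 here, so the jump set
  \<open>{i \<in> {1,\<dots>,n-1}. x\<^sub>i \<noteq> x\<^sub>i\<^sub>+\<^sub>1}\<close> becomes \<open>{i. Suc i < n \<and> x $ i \<noteq> x $ Suc i}\<close>.\<close>

definition jumps :: "real vec \<Rightarrow> nat" where
  "jumps x = card {i. Suc i < dim_vec x \<and> x $ i \<noteq> x $ Suc i}"

text \<open>The \<open>p\<close>-th power of the \<open>p\<close>-norm, without taking a root. Note that \<open>0 powr p = 0\<close>.\<close>

definition lp_pow :: "real \<Rightarrow> 'k::real_normed_field vec \<Rightarrow> real" where
  "lp_pow p y = (\<Sum>i<dim_vec y. norm (y $ i) powr p)"

text \<open>The variable \<open>x\<close> is real even when \<open>A\<close> and \<open>b\<close> are complex; it is embedded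
  entrywise by \<open>of_real\<close> (the identity in the real case).\<close>

definition inverse_potts ::
  "'k::real_normed_field mat \<Rightarrow> 'k vec \<Rightarrow> real \<Rightarrow> real \<Rightarrow> real vec \<Rightarrow> real" where
  "inverse_potts A b \<gamma> p x =
     \<gamma> * real (jumps x) + lp_pow p (A *\<^sub>v map_vec of_real x - b)"

end

theory Submission
  imports "HOL-Analysis.Topology_Euclidean_Space" Defs
begin

text \<open>The difficulty is that \<open>P\<^sub>\<gamma>\<close> need not be coercive, since \<open>A\<close> may have a kernel, so a minimizing
  sequence \<open>x\<^sub>t\<close> may be unbounded. The residuals \<open>A x\<^sub>t - b\<close>, however, stay bounded, and there are
  only finitely many possible jump sets. Along a subsequence the jump set is therefore a fixed set
  \<open>J\<close> and \<open>A x\<^sub>t\<close> converges to some \<open>y\<close>. The candidate minimizer is not a limit of the \<open>x\<^sub>t\<close>, but any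
  solution \<open>z\<close> of \<open>A z = y\<close> whose jumps lie in \<open>J\<close>; it satisfies
  \<open>P\<^sub>\<gamma>(z) \<le> lim P\<^sub>\<gamma>(x\<^sub>t) = inf P\<^sub>\<gamma>\<close>, because fewer jumps only lower the penalty.

  That such a \<open>z\<close> exists is the closedness of finite-dimensional subspaces
  (\<open>finite_real_span_closed_pointwise\<close>). The jump restriction needs no separate treatment: the
  conditions \<open>x\<^sub>i - x\<^sub>i\<^sub>+\<^sub>1 = 0\<close> for \<open>i \<notin> J\<close> are added to \<open>A\<close> as further rows, whose values along the
  sequence are constantly \<open>0\<close>.\<close>

no_notation Finite_Cartesian_Product.vec_nth (infixl \<open>$\<close> 90)

text \<open>The induction removes the last vector. If its coefficients are bounded, they converge along
  a subsequence, and so does the remaining sum. If they are unbounded, dividing by them exhibits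
  the last vector as a limit of combinations of the others; by the induction hypothesis it is such
  a combination itself, and it can be eliminated from the sequence. Convergence is pointwise on an
  arbitrary index set, so that spaces of varying dimension are covered by one type.\<close>

lemma finite_real_span_closed_pointwise:
  fixes v :: "nat \<Rightarrow> 'i \<Rightarrow> 'k::real_normed_vector" and X :: "nat \<Rightarrow> nat \<Rightarrow> real"
  assumes "\<And>i. i \<in> I \<Longrightarrow> (\<lambda>t. \<Sum>j<k. X t j *\<^sub>R v j i) \<longlonglongrightarrow> y i"
  shows "\<exists>c. \<forall>i\<in>I. (\<Sum>j<k. c j *\<^sub>R v j i) = y i"
  using assms
proof (induction k arbitrary: X y)
  case 0
  then have "\<forall>i\<in>I. y i = 0"
    by (simp add: LIMSEQ_const_iff)
  then show ?case by simp
next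
  case (Suc k)
  show ?case
  proof (cases "Bseq (\<lambda>t. X t k)")
    case True
    then have "bounded (range (\<lambda>t. X t k))"
      by (simp add: Bseq_eq_bounded)
    then obtain l r where r: "strict_mono r" and l: "((\<lambda>t. X t k) \<circ> r) \<longlonglongrightarrow> l"
      using bounded_imp_convergent_subsequence by blast
    have "(\<lambda>t. \<Sum>j<k. X (r t) j *\<^sub>R v j i) \<longlonglongrightarrow> y i - l *\<^sub>R v k i" if "i \<in> I" for i
    proof -
      have "(\<lambda>t. (\<Sum>j<Suc k. X (r t) j *\<^sub>R v j i) - X (r t) k *\<^sub>R v k i) \<longlonglongrightarrow> y i - l *\<^sub>R v k i"
        using LIMSEQ_subseq_LIMSEQ[OF Suc.prems[OF that] r] l
        by (intro tendsto_intros) (auto simp: o_def)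
      then show ?thesis by simp
    qed
    from Suc.IH[OF this] obtain c
      where "\<forall>i\<in>I. (\<Sum>j<k. c j *\<^sub>R v j i) = y i - l *\<^sub>R v k i" by blast
    then have "\<forall>i\<in>I. (\<Sum>j<Suc k. (c(k := l)) j *\<^sub>R v j i) = y i" by simp
    then show ?thesis by blast
  next
    case False
    \<comment> \<open>Requiring \<open>s \<ge> t\<close> makes the selected times tend to infinity, so that limits are inherited.\<close>
    have "\<exists>s\<ge>t. norm (X s k) > real t" for t
    proof (rule ccontr)
      assume "\<not> (\<exists>s\<ge>t. norm (X s k) > real t)"
      then have "Bseq (\<lambda>s. X (s + t) k)"
        by (intro BseqI'[of _ "real t"]) (auto simp: not_less)
      then show False using False Bseq_offset[of "\<lambda>s. X s k" t] by blast
    qed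
    then obtain r where r: "\<And>t. r t \<ge> t" and large: "\<And>t. norm (X (r t) k) > real t"
      by metis
    have r_top: "filterlim r at_top sequentially"
      by (rule filterlim_at_top_mono[OF filterlim_ident]) (use r in auto)
    have "filterlim (\<lambda>t. norm (X (r t) k)) at_top sequentially"
      by (rule filterlim_at_top_mono[OF filterlim_real_sequentially])
        (use large in \<open>auto intro: always_eventually less_imp_le\<close>)
    then have inv: "(\<lambda>t. inverse (X (r t) k)) \<longlonglongrightarrow> 0"
      by (intro tendsto_inverse_0[THEN filterlim_compose] filterlim_norm_at_top_imp_at_infinity)
    have nz: "X (r t) k \<noteq> 0" for t
      using large[of t] by auto
    have "(\<lambda>t. \<Sum>j<k. (X (r t) j / X (r t) k) *\<^sub>R v j i) \<longlonglongrightarrow> - v k i" if "i \<in> I" for i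
    proof -
      have "(\<lambda>t. inverse (X (r t) k) *\<^sub>R (\<Sum>j<Suc k. X (r t) j *\<^sub>R v j i) - v k i)
          \<longlonglongrightarrow> 0 *\<^sub>R y i - v k i"
        by (intro tendsto_intros inv filterlim_compose[OF Suc.prems[OF that] r_top])
      then show ?thesis
        using nz by (simp add: scaleR_add_right scaleR_sum_right field_simps)
    qed
    from Suc.IH[OF this] obtain d where d: "\<And>i. i \<in> I \<Longrightarrow> (\<Sum>j<k. d j *\<^sub>R v j i) = - v k i"
      by blast
    have "(\<Sum>j<k. (X t j - X t k * d j) *\<^sub>R v j i) = (\<Sum>j<Suc k. X t j *\<^sub>R v j i)" if "i \<in> I" for t i
    proof -
      have "(\<Sum>j<k. (X t k * d j) *\<^sub>R v j i) = X t k *\<^sub>R (\<Sum>j<k. d j *\<^sub>R v j i)"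
        by (simp add: scaleR_sum_right)
      then show ?thesis
        using d[OF that] by (simp add: scaleR_diff_left sum_subtractf)
    qed
    then have "(\<lambda>t. \<Sum>j<k. (X t j - X t k * d j) *\<^sub>R v j i) \<longlonglongrightarrow> y i" if "i \<in> I" for i
      using Suc.prems[OF that] that by simp
    from Suc.IH[OF this] obtain c where "\<forall>i\<in>I. (\<Sum>j<k. c j *\<^sub>R v j i) = y i" by blast
    then have "\<forall>i\<in>I. (\<Sum>j<Suc k. (c(k := 0)) j *\<^sub>R v j i) = y i" by simp
    then show ?thesis by blast
  qed
qed

lemma mult_mat_of_real_vec_index:
  fixes A :: "'k::real_normed_field mat"
  assumes "A \<in> carrier_mat m n" "x \<in> carrier_vec n" "i < m"
  shows "(A *\<^sub>v map_vec of_real x) $ i = (\<Sum>j<n. (x $ j) *\<^sub>R A $$ (i, j))"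
  using assms
  by (auto simp: scalar_prod_def scaleR_conv_of_real mult.commute lessThan_atLeast0 intro!: sum.cong)

lemma inverse_potts_alt:
  fixes A :: "'k::real_normed_field mat"
  assumes "A \<in> carrier_mat m n" "b \<in> carrier_vec m" "x \<in> carrier_vec n"
  shows "inverse_potts A b \<gamma> p x =
    \<gamma> * real (card {i. Suc i < n \<and> x $ i \<noteq> x $ Suc i}) +
    (\<Sum>i<m. norm ((\<Sum>j<n. (x $ j) *\<^sub>R A $$ (i, j)) - b $ i) powr p)"
  using assms mult_mat_of_real_vec_index[OF assms(1,3)]
  by (simp add: inverse_potts_def jumps_def lp_pow_def)

text \<open>Closedness of the image under \<open>A\<close> of the signals with jumps in \<open>J\<close>: the index \<open>Inl i\<close> stands
  for row \<open>i\<close> of \<open>A\<close>, and \<open>Inr i\<close> for the constraint row \<open>x\<^sub>i - x\<^sub>i\<^sub>+\<^sub>1\<close>.\<close>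

lemma image_of_restricted_jumps_closed:
  fixes A :: "'k::real_normed_field mat" and X :: "nat \<Rightarrow> real vec"
  assumes conv: "\<And>i. i < m \<Longrightarrow> (\<lambda>t. \<Sum>j<n. (X t $ j) *\<^sub>R A $$ (i, j)) \<longlonglongrightarrow> y i"
    and flat: "\<And>t i. Suc i < n \<Longrightarrow> i \<notin> J \<Longrightarrow> X t $ i = X t $ Suc i"
  shows "\<exists>z \<in> carrier_vec n. (\<forall>i<m. (\<Sum>j<n. (z $ j) *\<^sub>R A $$ (i, j)) = y i) \<and>
    {i. Suc i < n \<and> z $ i \<noteq> z $ Suc i} \<subseteq> J"
proof -
  define I :: "(nat + nat) set" where "I = Inl ` {..<m} \<union> Inr ` {i. Suc i < n \<and> i \<notin> J}"
  define v :: "nat \<Rightarrow> nat + nat \<Rightarrow> 'k" where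
    "v j e = (case e of Inl i \<Rightarrow> A $$ (i, j) | Inr i \<Rightarrow> of_bool (j = i) - of_bool (j = Suc i))" for j e
  have difference_row: "(\<Sum>j<n. c j *\<^sub>R v j (Inr i)) = of_real (c i - c (Suc i))"
    if "Suc i < n" for c i
  proof -
    have "(\<Sum>j<n. c j *\<^sub>R v j (Inr i)) =
        (\<Sum>j<n. if j = i then of_real (c j) else 0) - (\<Sum>j<n. if j = Suc i then of_real (c j) else 0)"
      unfolding sum_subtractf[symmetric]
      by (intro sum.cong) (auto simp: v_def scaleR_conv_of_real)
    then show ?thesis using that by simp
  qed
  have "(\<lambda>t. \<Sum>j<n. (X t $ j) *\<^sub>R v j e) \<longlonglongrightarrow> case_sum y (\<lambda>_. 0) e" if "e \<in> I" for e
  proof (cases e)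
    case (Inl i)
    then show ?thesis using that conv by (auto simp: I_def v_def)
  next
    case (Inr i)
    then have "Suc i < n" "i \<notin> J" using that by (auto simp: I_def)
    then show ?thesis using flat[of i] Inr by (simp add: difference_row)
  qed
  then have "\<exists>c. \<forall>e\<in>I. (\<Sum>j<n. c j *\<^sub>R v j e) = case_sum y (\<lambda>_. 0) e"
    by (rule finite_real_span_closed_pointwise)
  then obtain c where c: "\<forall>e\<in>I. (\<Sum>j<n. c j *\<^sub>R v j e) = case_sum y (\<lambda>_. 0) e" ..
  show ?thesis
  proof (intro bexI conjI allI impI)
    show "vec n c \<in> carrier_vec n" by simp
    show "(\<Sum>j<n. (vec n c $ j) *\<^sub>R A $$ (i, j)) = y i" if "i < m" for i
      using c[rule_format, of "Inl i"] that by (simp add: I_def v_def)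
    have "i \<in> J" if "Suc i < n" "c i \<noteq> c (Suc i)" for i
    proof (rule ccontr)
      assume "i \<notin> J"
      then have "of_real (c i - c (Suc i)) = (0::'k)"
        using c[rule_format, of "Inr i"] that by (simp add: I_def difference_row del: of_real_diff)
      then show False using that by (simp del: of_real_diff)
    qed
    then show "{i. Suc i < n \<and> vec n c $ i \<noteq> vec n c $ Suc i} \<subseteq> J" by auto
  qed
qed

theorem inverse_potts_has_minimizer:
  fixes A :: "'k::{real_normed_field, heine_borel} mat"
  assumes A: "A \<in> carrier_mat m n" and b: "b \<in> carrier_vec m" and \<gamma>: "\<gamma> \<ge> 0" and p: "p > 0"
  shows "\<exists>xs \<in> carrier_vec n. \<forall>x \<in> carrier_vec n. inverse_potts A b \<gamma> p xs \<le> inverse_potts A b \<gamma> p x"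
proof -
  define P where "P = inverse_potts A b \<gamma> p"
  define jset where "jset x = {i. Suc i < n \<and> x $ i \<noteq> x $ Suc i}" for x :: "real vec"
  define res where "res x i = (\<Sum>j<n. (x $ j) *\<^sub>R A $$ (i, j)) - b $ i" for x i
  have P_eq: "P x = \<gamma> * real (card (jset x)) + (\<Sum>i<m. norm (res x i) powr p)"
    if "x \<in> carrier_vec n" for x
    using inverse_potts_alt[OF A b that] by (simp add: P_def jset_def res_def)
  have fin_jset: "jset x \<in> Pow {..<n}" for x
    by (auto simp: jset_def)
  have P_nonneg: "P x \<ge> 0" if "x \<in> carrier_vec n" for x
    using P_eq[OF that] \<gamma> by (simp add: sum_nonneg)
  define c where "c = (INF x \<in> carrier_vec n. P x)"
  have bdd: "bdd_below (P ` carrier_vec n)"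
    using P_nonneg by (intro bdd_belowI[of _ 0]) auto
  have ne: "carrier_vec n \<noteq> ({} :: real vec set)"
    using zero_carrier_vec by blast
  have "\<exists>x \<in> carrier_vec n. P x < c + inverse (real (Suc t))" for t
    using cINF_less_iff[OF ne bdd, of "c + inverse (real (Suc t))"] by (simp add: c_def)
  then obtain X where X: "\<And>t. X t \<in> carrier_vec n"
    and X_less: "\<And>t. P (X t) < c + inverse (real (Suc t))"
    by metis

  \<comment> \<open>Pass to a subsequence along which the jump set is constant.\<close>
  have "finite (range (\<lambda>t. jset (X t)))"
    by (rule finite_subset[of _ "Pow {..<n}"]) (use fin_jset in auto)
  then obtain t0 where inf: "infinite {t \<in> UNIV. jset (X t) = jset (X t0)}"
    using pigeonhole_infinite[of UNIV "\<lambda>t. jset (X t)"] by auto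
  define J where "J = jset (X t0)"
  obtain r :: "nat \<Rightarrow> nat" where r: "strict_mono r" and r_J: "\<And>t. jset (X (r t)) = J"
    using infinite_enumerate[OF inf] by (auto simp: J_def)

  have res_bound: "norm (res (X t) i) \<le> (c + 1) powr (1 / p)" if "i < m" for t i
  proof -
    have "norm (res (X t) i) powr p \<le> (\<Sum>i<m. norm (res (X t) i) powr p)"
      using that by (intro member_le_sum) auto
    also have "\<dots> \<le> P (X t)"
      using P_eq[OF X] \<gamma> by simp
    also have "\<dots> \<le> c + 1"
      using X_less[of t] inverse_le_1_iff[of "real (Suc t)"] by linarith
    finally have "(norm (res (X t) i) powr p) powr (1 / p) \<le> (c + 1) powr (1 / p)"
      using p by (intro powr_mono2) auto
    then show ?thesis using p by (simp add: powr_powr)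
  qed
  \<comment> \<open>Bolzano-Weierstrass in the first \<open>m\<close> coordinates; \<open>l\<close> is the limiting residual.\<close>
  have "\<forall>d\<subseteq>{..<m}. \<exists>l. \<exists>s. strict_mono s \<and> (\<forall>e>0. eventually
      (\<lambda>t. \<forall>i\<in>d. dist ((\<lambda>t. res (X (r t))) (s t) i) (l i) < e) sequentially)"
    by (rule compact_lemma_general[where unproj = "\<lambda>x. x"])
      (auto simp: image_image intro!: boundedI res_bound)
  then obtain l s where s: "strict_mono s"
    and l_ev: "\<And>e. e > 0 \<Longrightarrow> eventually (\<lambda>t. \<forall>i\<in>{..<m}. dist (res (X (r (s t))) i) (l i) < e) sequentially"
    by blast
  define Y where "Y t = X (r (s t))" for t
  have l: "(\<lambda>t. res (Y t) i) \<longlonglongrightarrow> l i" if "i < m" for i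
  proof (rule tendstoI)
    fix e :: real assume "e > 0"
    from l_ev[OF this] show "eventually (\<lambda>t. dist (res (Y t) i) (l i) < e) sequentially"
      by eventually_elim (use that in \<open>auto simp: Y_def\<close>)
  qed
  have Y: "Y t \<in> carrier_vec n" "jset (Y t) = J" for t
    using X r_J by (auto simp: Y_def)

  have "(\<lambda>t. \<Sum>j<n. (Y t $ j) *\<^sub>R A $$ (i, j)) \<longlonglongrightarrow> l i + b $ i" if "i < m" for i
    using tendsto_add[OF l[OF that] tendsto_const[of "b $ i"]] by (simp add: res_def)
  moreover have "Y t $ i = Y t $ Suc i" if "Suc i < n" "i \<notin> J" for t i
    using Y(2)[of t] that by (auto simp: jset_def)
  ultimately have "\<exists>z \<in> carrier_vec n.
      (\<forall>i<m. (\<Sum>j<n. (z $ j) *\<^sub>R A $$ (i, j)) = l i + b $ i) \<and>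
      {i. Suc i < n \<and> z $ i \<noteq> z $ Suc i} \<subseteq> J"
    by (rule image_of_restricted_jumps_closed)
  then obtain z where z: "z \<in> carrier_vec n"
    and Az: "\<And>i. i < m \<Longrightarrow> (\<Sum>j<n. (z $ j) *\<^sub>R A $$ (i, j)) = l i + b $ i"
    and z_J: "{i. Suc i < n \<and> z $ i \<noteq> z $ Suc i} \<subseteq> J"
    by auto

  have "P z \<le> c"
  proof -
    have "finite J"
      using fin_jset[of "X t0"] finite_subset[of J "{..<n}"] by (simp add: J_def)
    then have "card (jset z) \<le> card J"
      using z_J by (intro card_mono) (auto simp: jset_def)
    then have "P z \<le> \<gamma> * real (card J) + (\<Sum>i<m. norm (l i) powr p)"
      using P_eq[OF z] \<gamma> Az by (simp add: res_def mult_left_mono)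
    also have "\<dots> \<le> c"
    proof (rule LIMSEQ_le)
      show "(\<lambda>t. P (Y t)) \<longlonglongrightarrow> \<gamma> * real (card J) + (\<Sum>i<m. norm (l i) powr p)"
      proof -
        have "(\<lambda>t. norm (res (Y t) i) powr p) \<longlonglongrightarrow> norm (l i) powr p" if "i < m" for i
          by (rule tendsto_powr'[OF tendsto_norm[OF l[OF that]] tendsto_const]) (simp add: p)
        then have "(\<lambda>t. \<Sum>i<m. norm (res (Y t) i) powr p) \<longlonglongrightarrow> (\<Sum>i<m. norm (l i) powr p)"
          by (intro tendsto_sum) simp
        from tendsto_add[OF tendsto_const this] show ?thesis
          by (simp add: P_eq[OF Y(1)] Y(2))
      qed
      have "(\<lambda>t. c + inverse (real (Suc t))) \<longlonglongrightarrow> c + 0"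
        by (intro tendsto_add tendsto_const LIMSEQ_inverse_real_of_nat)
      from LIMSEQ_subseq_LIMSEQ[OF this strict_mono_o[OF r s]]
      show "(\<lambda>t. c + inverse (real (Suc (r (s t))))) \<longlonglongrightarrow> c"
        by (simp add: o_def)
      show "\<exists>N. \<forall>t\<ge>N. P (Y t) \<le> c + inverse (real (Suc (r (s t))))"
        unfolding Y_def by (intro exI[of _ 0] allI impI less_imp_le X_less)
    qed
    finally show ?thesis .
  qed
  then have "P z \<le> P x" if "x \<in> carrier_vec n" for x
    using cINF_lower[OF bdd that] unfolding c_def by linarith
  then show ?thesis
    unfolding P_def by (intro bexI[OF _ z] ballI)
qed

theorem theorem1:
  fixes m n :: nat and \<gamma> p :: real
  assumes "m \<ge> 1" and "n \<ge> 1" and "\<gamma> > 0" and "p \<ge> 1"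
  shows "(\<forall>A \<in> carrier_mat m n. \<forall>b \<in> carrier_vec m.
            \<exists>xs \<in> carrier_vec n. \<forall>x \<in> carrier_vec n.
              inverse_potts (A :: real mat) b \<gamma> p xs \<le> inverse_potts A b \<gamma> p x) \<and>
         (\<forall>A \<in> carrier_mat m n. \<forall>b \<in> carrier_vec m.
            \<exists>xs \<in> carrier_vec n. \<forall>x \<in> carrier_vec n.
              inverse_potts (A :: complex mat) b \<gamma> p xs \<le> inverse_potts A b \<gamma> p x)"
proof (intro conjI ballI)
  have "\<gamma> \<ge> 0" "p > 0" using assms by auto
  then show "\<exists>xs \<in> carrier_vec n. \<forall>x \<in> carrier_vec n.
      inverse_potts A b \<gamma> p xs \<le> inverse_potts A b \<gamma> p x"
    if "A \<in> carrier_mat m n" "b \<in> carrier_vec m" for A :: "real mat" and b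
    by (rule inverse_potts_has_minimizer[OF that])
  from \<open>\<gamma> \<ge> 0\<close> \<open>p > 0\<close> show "\<exists>xs \<in> carrier_vec n. \<forall>x \<in> carrier_vec n.
      inverse_potts A b \<gamma> p xs \<le> inverse_potts A b \<gamma> p x"
    if "A \<in> carrier_mat m n" "b \<in> carrier_vec m" for A :: "complex mat" and b
    by (rule inverse_potts_has_minimizer[OF that])
qed

end
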